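(* For every positive integer $n$, the number of friezes of type $B_n$ is $$\sum_{1\le m\le\sqrt{n+1}}\binom{2n-m^2+1}{n}.$$
   Context: A frieze of type $\Delta$ is a ring homomorphism from the coefficient-free cluster algebra of type $\Delta$ to $\mathbb{Z}$ sending every cluster variable to a positive integer (equivalently, positive integers $a(j,m)$ satisfying $a(j,m)a(j,m+1)=1+\prod_{j\to i}a(i,m)^{|C_{i,j}|}\prod_{i\to j}a(i,m+1)^{|C_{i,j}|}$ for the Cartan matrix $C$ and an acyclic orientation). Here type $B_n$ is the type obtained by folding $D_{n+1}$ by the automorphism swapping the two short arms of the Dynkin diagram. *)

theory Defs
  imports Complex_Main "HOL-Library.FuncSet"
begin

(* Cartan matrix of type D_N on the vertices {1..N}: the path 1 - 2 - ... - (N-1), with the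
   vertex N attached to N-2.  The two short arms are N-1 and N.  For N = 2 this is A_1 x A_1 and
   for N = 3 it is A_3 with middle vertex 1. *)
definition cartan_D :: "nat \<Rightarrow> nat \<Rightarrow> nat \<Rightarrow> int" where
  "cartan_D N i j =
     (if i = j then 2
      else if j = i + 1 \<and> j < N \<or> i = j + 1 \<and> i < N
            \<or> j = N \<and> i + 2 = N \<or> i = N \<and> j + 2 = N then - 1
      else 0)"

(* Cartan matrix of type B_n on the vertices {1..n}.  The entry C(n,n-1) is the -2: in the frieze
   relation at the vertex n-1 the variable of the vertex n occurs squared, as it stands for the
   two identified short arms of D_(n+1); see cartan_B_folding. *)
definition cartan_B :: "nat \<Rightarrow> nat \<Rightarrow> nat \<Rightarrow> int" where
  "cartan_B n i j =
     (if i = j then 2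
      else if i = n \<and> j + 1 = n then - 2
      else if j = i + 1 \<or> i = j + 1 then - 1
      else 0)"

lemma cartan_B_folding:
  assumes "i \<in> {1..n}" "j \<in> {1..n}"
  shows "cartan_B n i j = (\<Sum>k\<in>(if i = n then {n, n + 1} else {i}). cartan_D (n + 1) k j)"
  using assms by (auto simp: cartan_B_def cartan_D_def)

(* (i, j) in R stands for an arrow i --> j.  Acyclicity excludes loops and arrows in both
   directions between two vertices. *)
definition acyclic_orientation ::
    "nat set \<Rightarrow> (nat \<Rightarrow> nat \<Rightarrow> int) \<Rightarrow> (nat \<times> nat) set \<Rightarrow> bool" where
  "acyclic_orientation V C R \<longleftrightarrow>
     R \<subseteq> V \<times> V \<and>
     (\<forall>i\<in>V. \<forall>j\<in>V. i \<noteq> j \<longrightarrow> (C i j \<noteq> 0 \<longleftrightarrow> (i, j) \<in> R \<or> (j, i) \<in> R)) \<and>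
     acyclic R"

(* A frieze is the array of positive integers a(j,m), j in V and m in Z; it is extended
   by undefined outside V, so that different elements of the set are different friezes. *)
definition friezes ::
    "nat set \<Rightarrow> (nat \<Rightarrow> nat \<Rightarrow> int) \<Rightarrow> (nat \<times> nat) set \<Rightarrow> (nat \<times> int \<Rightarrow> int) set" where
  "friezes V C R =
     {a \<in> V \<times> UNIV \<rightarrow>\<^sub>E {0<..}. \<forall>j\<in>V. \<forall>m.
        a (j, m) * a (j, m + 1) =
          1 + (\<Prod>i | (j, i) \<in> R. a (i, m) ^ nat \<bar>C i j\<bar>)
            * (\<Prod>i | (i, j) \<in> R. a (i, m + 1) ^ nat \<bar>C i j\<bar>)}"

end

theory Submission
  imports Defs
begin

text \<open>A frieze of type \<open>B\<^sub>n\<close> is determined by its last row \<open>c\<close>, the values of the arcs from the \<open>n + 1\<close>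
  vertices of a once-punctured polygon to the puncture. By the Ptolemy relations, the rows that occur are
  the \<open>(n + 1)\<close>-periodic sequences of positive integers in which every \<open>c\<^sub>i\<close> divides
  \<open>c\<^bsub>i-1\<^esub> + c\<^bsub>i+1\<^esub>\<close> and for which \<open>1 / (c\<^sub>i c\<^bsub>i+1\<^esub>)\<close> sums to 1 over a period. If \<open>c\<close> is not constant,
  convexity yields an ear, that is, an entry \<open>c\<^sub>i = c\<^bsub>i-1\<^esub> + c\<^bsub>i+1\<^esub>\<close>; removing it preserves divisibility and
  the sum. Hence \<open>c\<close> arises from a constant sequence \<open>m, ..., m\<close> by inserting mediants, and the sum forces
  its length to be \<open>m\<^sup>2\<close>. Those sequences that start with \<open>m\<close> are counted by a ballot number, and rotating
  them yields the binomial coefficient belonging to \<open>m\<close>.\<close>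

subsection \<open>Words obtained by inserting mediants\<close>

text \<open>A left-to-right parser: \<open>l\<close> is the last letter that was emitted, and \<open>st\<close> are the letters that
  are known to follow, with mediants still to be inserted in front of them.\<close>

inductive farey_word :: "int \<Rightarrow> int list \<Rightarrow> int list \<Rightarrow> bool" where
  Nil: "farey_word l [] []"
| Emit: "farey_word r st w \<Longrightarrow> farey_word l (r # st) (r # w)"
| Split: "farey_word l ((l + r) # r # st) w \<Longrightarrow> farey_word l (r # st) w"

lemma farey_word_Nil_iff [simp]: "farey_word l [] w \<longleftrightarrow> w = []"
  by (subst farey_word.simps) auto

lemma farey_word_Cons_iff:
  "farey_word l (r # st) w \<longleftrightarrow>
    (\<exists>w'. w = r # w' \<and> farey_word r st w') \<or> farey_word l ((l + r) # r # st) w"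
  by (subst farey_word.simps) auto

fun dvd_chain :: "int list \<Rightarrow> bool" where
  "dvd_chain (a # b # c # xs) \<longleftrightarrow> b dvd a + c \<and> dvd_chain (b # c # xs)"
| "dvd_chain _ \<longleftrightarrow> True"

fun recip_sum :: "int list \<Rightarrow> real" where
  "recip_sum (a # b # xs) = 1 / (a * b) + recip_sum (b # xs)"
| "recip_sum _ = 0"

section \<open>Invariants of inserting mediants\<close>

lemma farey_word_length: "farey_word l st w \<Longrightarrow> length st \<le> length w"
  by (induction rule: farey_word.induct) auto

text \<open>Each letter put in front of the pending head exceeds it by \<open>l\<close>. The bound
  later makes the parser unambiguous; the congruence preserves divisibility at the letter emitted
  last.\<close>

lemma farey_word_hd:
  "farey_word l st w \<Longrightarrow> 0 < l \<Longrightarrow> st \<noteq> [] \<Longrightarrow>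
    w \<noteq> [] \<and> hd st \<le> hd w \<and> l dvd hd w - hd st"
proof (induction rule: farey_word.induct)
  case (Split l r st w)
  then have "l dvd (hd w - (l + r)) + l" by (intro dvd_add) auto
  with Split show ?case by auto
qed auto

lemma farey_word_last: "farey_word l st w \<Longrightarrow> st \<noteq> [] \<Longrightarrow> last w = last st"
proof (induction rule: farey_word.induct)
  case (Emit r st w l)
  then show ?case by (cases "st = []") (auto dest: farey_word_length)
qed auto

lemma farey_word_lower_bound:
  "farey_word l st w \<Longrightarrow> 0 < m \<Longrightarrow> m \<le> l \<Longrightarrow> \<forall>x\<in>set st. m \<le> x \<Longrightarrow> \<forall>x\<in>set w. m \<le> x"
  by (induction rule: farey_word.induct) auto

lemma farey_word_dvd:
  "farey_word l st w \<Longrightarrow> m dvd l \<Longrightarrow> \<forall>x\<in>set st. m dvd x \<Longrightarrow> \<forall>x\<in>set w. m dvd x"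
  by (induction rule: farey_word.induct) auto

text \<open>A mediant of letters that are at least \<open>m\<close> is at least
  \<open>2 * m\<close>, so no new occurrence of the minimum arises.\<close>

lemma farey_word_count_min:
  "farey_word l st w \<Longrightarrow> 0 < m \<Longrightarrow> m \<le> l \<Longrightarrow> \<forall>x\<in>set st. m \<le> x \<Longrightarrow>
    count_list w m = count_list st m"
  by (induction rule: farey_word.induct) auto

text \<open>A mediant splits one summand into two:
  \<open>1 / (l r) = 1 / (l (l + r)) + 1 / ((l + r) r)\<close>.\<close>

lemma farey_word_recip_sum:
  "farey_word l st w \<Longrightarrow> 0 < l \<Longrightarrow> \<forall>x\<in>set st. 0 < x \<Longrightarrow> recip_sum (l # w) = recip_sum (l # st)"
proof (induction rule: farey_word.induct)
  case (Split l r st w)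
  have "0 < real_of_int l" "0 < real_of_int r" "0 < real_of_int l + real_of_int r"
    using Split.prems by auto
  then have "1 / (real_of_int l * r) = 1 / (l * (l + r)) + 1 / ((l + r) * r)"
    by (simp add: divide_simps add.commute)
  with Split show ?case by auto
qed auto

text \<open>A mediant is the sum of its neighbours, and inserting it raises the neighbour sum of an
  adjacent letter by that letter itself.\<close>

lemma farey_word_dvd_chain:
  "farey_word l st w \<Longrightarrow> 0 < l \<Longrightarrow> \<forall>x\<in>set st. 0 < x \<Longrightarrow> dvd_chain (l # st) \<Longrightarrow> dvd_chain (l # w)"
proof (induction rule: farey_word.induct)
  case (Emit r st w l)
  show ?case
  proof (cases st)
    case Nil
    with Emit.hyps have "w = []" by simp
    then show ?thesis by simp
  next
    case (Cons r' st')
    \<comment> \<open>The letter following \<open>r\<close> need not be \<open>r'\<close>, but it is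
      congruent to \<open>r'\<close> modulo \<open>r\<close>.\<close>
    with farey_word_hd[OF Emit.hyps] Emit.prems obtain y w' where
      w: "w = y # w'" and "r dvd y - r'" by (cases w) auto
    moreover have "r dvd l + r'" using Emit.prems Cons by simp
    ultimately have "r dvd l + y"
      using dvd_add[of r "y - r'" "l + r'"] by (simp add: algebra_simps)
    moreover have "dvd_chain (r # w)" using Emit Cons by auto
    ultimately show ?thesis using w by simp
  qed
next
  case (Split l r st w)
  have "dvd_chain (l # (l + r) # r # st)"
    using Split.prems(3) by (cases st) (auto simp: add.assoc add.left_commute[of _ r])
  with Split show ?case by auto
qed auto

text \<open>Closure under insertion at any place, to undo the removal of an ear: when
  \<open>c\<close> would be emitted right after \<open>a\<close>, a \<open>Split\<close> and two
  \<open>Emit\<close> steps are performed instead.\<close>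

lemma farey_word_insert_mediant:
  assumes "farey_word l st w" "l # w = u @ [a, c] @ v"
  shows "\<exists>w'. l # w' = u @ [a, a + c, c] @ v \<and> farey_word l st w'"
  using assms
proof (induction arbitrary: u rule: farey_word.induct)
  case (Emit r st w l)
  show ?case
  proof (cases u)
    case Nil
    with Emit have "a = l" "c = r" "v = w" by auto
    then show ?thesis using Nil Emit.hyps by (auto intro!: farey_word.Split farey_word.Emit)
  next
    case (Cons x u')
    with Emit.prems Emit.IH[of u'] obtain w' where
      "r # w' = u' @ [a, a + c, c] @ v" "farey_word r st w'" by auto
    then have "l # r # w' = u @ [a, a + c, c] @ v" "farey_word l (r # st) (r # w')"
      using Cons Emit.prems by (simp, intro farey_word.Emit)
    then show ?thesis by blast
  qed
next
  case (Split l r st w)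
  then show ?case by (meson farey_word.Split)
qed auto

text \<open>Only the letters next to the ear are affected: the neighbour sum of \<open>a\<close>
  drops by \<open>a\<close> and that of \<open>c\<close> by \<open>c\<close>.\<close>

lemma dvd_chain_remove_ear:
  "dvd_chain (u @ [a, a + c, c] @ v) \<Longrightarrow> dvd_chain (u @ [a, c] @ v)"
proof (induction u rule: induct_list012)
  case 1
  have "c dvd a + d" if "c dvd a + c + d" for d
    using dvd_diff[OF that dvd_refl] by (simp add: algebra_simps)
  with 1 show ?case by (cases v) auto
next
  case (2 p)
  have *: "c dvd a + d" if "c dvd a + c + d" for d
    using dvd_diff[OF that dvd_refl] by (simp add: algebra_simps)
  have "a dvd p + c"
    using 2 dvd_diff[of a "p + (a + c)" a] by (simp add: algebra_simps)
  with 2 * show ?case by (cases v) auto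
next
  case (3 p q u)
  then show ?case by (cases u) auto
qed

text \<open>Without an ear the entries are convex, as every quotient \<open>(a + c) / b\<close> is at least 2.\<close>

lemma convex_chain_sorted:
  assumes "dvd_chain (a # b # xs)" "\<forall>x\<in>set (a # b # xs). 0 < x" "a \<le> b"
    and "\<And>u x z v. a # b # xs \<noteq> u @ [x, x + z, z] @ v"
  shows "sorted (a # b # xs)"
  using assms
proof (induction xs arbitrary: a b)
  case (Cons c xs)
  obtain k where k: "a + c = b * k" using Cons.prems by (auto elim: dvdE)
  have "k \<noteq> 1"
    using Cons.prems(4)[of "[]" a c xs] k by auto
  moreover have "k > 0"
    using k Cons.prems(2) by (metis add_pos_pos list.set_intros zero_less_mult_pos)
  ultimately have "2 \<le> k" by simp
  then have "b * 2 \<le> b * k" using Cons.prems(2) by (intro mult_left_mono) auto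
  then have "b \<le> c" using k Cons.prems(3) by linarith
  moreover have "b # c # xs \<noteq> u @ [x, x + z, z] @ v" for u x z v
    using Cons.prems(4)[of "a # u" x z v] by auto
  ultimately have "sorted (b # c # xs)"
    using Cons.prems by (intro Cons.IH) auto
  then show ?case using Cons.prems by auto
qed auto

text \<open>Induction on the length: an ear is removed and, after the induction hypothesis, put back
  as a mediant. With no ear left the word increases weakly from \<open>m\<close> and yet ends in
  \<open>m\<close>, so it is constant.\<close>

lemma dvd_chain_imp_farey_word:
  assumes "dvd_chain (m # w)" "\<forall>x\<in>set w. m \<le> x" "0 < m" "w \<noteq> []" "last w = m"
  shows "\<exists>k. farey_word m (replicate k m) w"
  using assms
proof (induction "length w" arbitrary: w rule: less_induct)
  case less
  show ?case
  proof (cases "\<exists>u a c v. m # w = u @ [a, a + c, c] @ v")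
    case True
    then obtain u a c v where e: "m # w = u @ [a, a + c, c] @ v" by blast
    obtain w' where w': "m # w' = u @ [a, c] @ v" using e by (cases u) auto
    have "length (m # w') < length (m # w)" unfolding e w' by simp
    moreover have "dvd_chain (m # w')"
      unfolding w' using less.prems(1) e dvd_chain_remove_ear by metis
    moreover have "set (m # w') \<subseteq> set (m # w)" unfolding e w' by auto
    moreover have "last (m # w') = last (m # w)" unfolding e w' by simp
    moreover have "w' \<noteq> []" using w' by (cases u) auto
    ultimately obtain k where "farey_word m (replicate k m) w'"
      using less.hyps[of w'] less.prems by auto
    from farey_word_insert_mediant[OF this w'] obtain w'' where
      "m # w'' = m # w" "farey_word m (replicate k m) w''"
      unfolding e by blast
    then show ?thesis by auto
  next
    case False
    obtain b xs where w: "w = b # xs" using less.prems by (cases w) auto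
    have "sorted (m # b # xs)"
      using False less.prems w by (intro convex_chain_sorted) auto
    then have "x = m" if "x \<in> set w" for x
    proof -
      have "w = butlast w @ [m]" using less.prems by (metis append_butlast_last_id)
      moreover have "sorted w" using \<open>sorted (m # b # xs)\<close> w by simp
      ultimately have "sorted (butlast w @ [m])" by simp
      then have "\<forall>x\<in>set (butlast w @ [m]). x \<le> m" by (auto simp: sorted_append)
      then have "\<forall>x\<in>set w. x \<le> m" using \<open>w = butlast w @ [m]\<close> by simp
      then show ?thesis using that less.prems by fastforce
    qed
    then have "w = replicate (length w) m" by (metis replicate_length_same)
    moreover have "farey_word l (replicate k m) (replicate k m)" for l k
      by (induction k arbitrary: l) (auto intro: farey_word.Emit)
    ultimately show ?thesis by metis
  qed
qed

subsection \<open>Counting words\<close>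

text \<open>For \<open>k > 0\<close> this is \<open>k / (2 s + k) * ((2 s + k) choose s)\<close>,
  the \<open>k\<close>-fold convolution of the Catalan numbers. It counts \<open>k\<close> binary
  trees with \<open>s\<close> inner nodes in all: one tree of mediants for each pending letter. The
  case \<open>s = 0\<close> is separate because \<open>s - 1\<close> is truncated.\<close>

definition ballot :: "nat \<Rightarrow> nat \<Rightarrow> int" where
  "ballot k s = (if s = 0 then 1
    else int ((2 * s + k - 1) choose s) - int ((2 * s + k - 1) choose (s - 1)))"

lemma ballot_0_Suc: "ballot 0 (Suc s) = 0"
  using binomial_symmetric[of s "Suc (2 * s)"] by (simp add: ballot_def)

lemma ballot_Suc_0: "ballot k 0 = 1"
  by (simp add: ballot_def)

text \<open>Pascal's rule; the two terms on the right mirror \<open>Emit\<close> and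
  \<open>Split\<close>.\<close>

lemma ballot_Suc_Suc: "ballot (Suc k) (Suc s) = ballot k (Suc s) + ballot (Suc (Suc k)) s"
proof (cases s)
  case 0
  then show ?thesis by (simp add: ballot_def)
next
  case (Suc t)
  then show ?thesis by (simp add: ballot_def)
qed

text \<open>The closed form without division, from the two absorption identities. With
  \<open>k = m^2\<close> and \<open>s + k\<close> the period, it matches the double count of the
  cycles.\<close>

lemma ballot_mult: "0 < k \<Longrightarrow> int (s + k) * ballot k s = int k * int ((2 * s + k - 1) choose s)"
proof (cases s)
  case (Suc t)
  assume "0 < k"
  then obtain j where k: "k = Suc j" by (cases k) auto
  have "(2 * t + j + 2 choose t) * (t + j + 2) = (2 * t + j + 2 choose Suc t) * Suc t"
    using binomial_absorb_comp[of "2 * t + j + 2" t] binomial_absorption[of t "2 * t + j + 2"]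
    by (simp add: mult.commute[of _ "_ choose _"] del: binomial_Suc_Suc)
  then have "int (2 * t + j + 2 choose t) * (t + j + 2) = int (2 * t + j + 2 choose Suc t) * Suc t"
    by (metis of_nat_mult)
  then show ?thesis using Suc k by (simp add: ballot_def algebra_simps del: binomial_Suc_Suc)
qed (simp add: ballot_def)

definition farey_words :: "int \<Rightarrow> int list \<Rightarrow> nat \<Rightarrow> int list set" where
  "farey_words l st s = {w. farey_word l st w \<and> length w = length st + s}"

lemma farey_words_Nil: "farey_words l [] s = (if s = 0 then {[]} else {})"
  by (auto simp: farey_words_def)

lemma farey_words_Cons_0: "farey_words l (r # st) 0 = (#) r ` farey_words r st 0"
  by (subst farey_words_def, subst farey_word_Cons_iff)
    (auto simp: farey_words_def dest: farey_word_length)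

lemma farey_words_Cons_Suc:
  "farey_words l (r # st) (Suc s) =
    (#) r ` farey_words r st (Suc s) \<union> farey_words l ((l + r) # r # st) s"
  by (subst farey_words_def, subst farey_word_Cons_iff) (auto simp: farey_words_def)

text \<open>Induction on \<open>s\<close> and, inside it, on \<open>st\<close>, following the
  recurrence of \<open>ballot\<close>. The two parts are disjoint: after an \<open>Emit\<close> the
  word starts with \<open>r\<close>, after a \<open>Split\<close> with a letter that is at least
  \<open>l + r\<close>.\<close>

lemma card_farey_words:
  assumes "0 < l" "\<forall>x\<in>set st. 0 < x"
  shows "finite (farey_words l st s) \<and> int (card (farey_words l st s)) = ballot (length st) s"
  using assms
proof (induction s arbitrary: l st)
  case 0
  then show ?case
    by (induction st arbitrary: l)
      (auto simp: farey_words_Nil farey_words_Cons_0 ballot_Suc_0 card_image)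
next
  case (Suc s)
  from Suc.prems show ?case
  proof (induction st arbitrary: l)
    case Nil
    then show ?case by (simp add: farey_words_Nil ballot_0_Suc)
  next
    case (Cons r st)
    have "hd w \<noteq> r" if "w \<in> farey_words l ((l + r) # r # st) s" for w
      using that farey_word_hd Cons.prems by (fastforce simp: farey_words_def)
    then have "(#) r ` farey_words r st (Suc s) \<inter> farey_words l ((l + r) # r # st) s = {}"
      by (force simp: disjoint_iff)
    moreover have "finite (farey_words r st (Suc s))"
      "int (card (farey_words r st (Suc s))) = ballot (length st) (Suc s)"
      using Cons.IH[of r] Cons.prems by auto
    moreover have "finite (farey_words l ((l + r) # r # st) s)"
      "int (card (farey_words l ((l + r) # r # st) s)) = ballot (Suc (Suc (length st))) s"
      using Suc.IH[of l "(l + r) # r # st"] Cons.prems by auto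
    ultimately show ?case
      by (simp add: farey_words_Cons_Suc card_Un_disjoint card_image ballot_Suc_Suc)
  qed
qed

section \<open>Indexed forms of chains and sums, and periodic functions\<close>

lemma dvd_chain_iff_nth:
  "dvd_chain xs \<longleftrightarrow> (\<forall>i. i + 2 < length xs \<longrightarrow> xs ! Suc i dvd xs ! i + xs ! (i + 2))"
proof (induction xs rule: dvd_chain.induct)
  case (1 a b c xs)
  have *: "(\<forall>i. P i) \<longleftrightarrow> P 0 \<and> (\<forall>i. P (Suc i))" for P :: "nat \<Rightarrow> bool"
    by (metis not0_implies_Suc)
  show ?case
    by (subst *) (simp add: 1)
qed auto

lemma recip_sum_conv_nth:
  "recip_sum xs = (\<Sum>i<length xs - 1. 1 / (real_of_int (xs ! i) * real_of_int (xs ! Suc i)))"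
  by (induction xs rule: recip_sum.induct) (auto simp: sum.lessThan_Suc_shift simp del: sum.lessThan_Suc)

lemma recip_sum_replicate: "recip_sum (m # replicate k m) = k / m\<^sup>2"
  by (induction k) (auto simp: power2_eq_square add_divide_distrib)

lemma sum_window_periodic:
  fixes f :: "int \<Rightarrow> 'a::ab_group_add"
  assumes "\<And>i. f (i + int N) = f i"
  shows "(\<Sum>l<N. f (q + int l)) = (\<Sum>l<N. f (int l))"
proof -
  have step: "(\<Sum>l<N. f (q + 1 + int l)) = (\<Sum>l<N. f (q + int l))" for q
  proof -
    have "f q + (\<Sum>l<N. f (q + 1 + int l)) = (\<Sum>l<Suc N. f (q + int l))"
      by (simp add: sum.lessThan_Suc_shift add.assoc del: sum.lessThan_Suc)
    also have "\<dots> = f q + (\<Sum>l<N. f (q + int l))"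
      using assms by (simp add: add.commute)
    finally show ?thesis by simp
  qed
  show ?thesis
  proof (induction q rule: int_induct[of _ 0])
    case (step2 i)
    then show ?case using step[of "i - 1"] by simp
  qed (use step in auto)
qed

lemma periodic_mod:
  fixes f :: "int \<Rightarrow> 'a"
  assumes "\<And>i. f (i + N) = f i"
  shows "f (t mod N) = f t"
proof -
  have "f (t mod N + k * N) = f (t mod N)" for k
  proof (induction k rule: int_induct[of _ 0])
    case (step1 i)
    then show ?case using assms[of "t mod N + i * N"] by (simp add: algebra_simps)
  next
    case (step2 i)
    then show ?case using assms[of "t mod N + (i - 1) * N"] by (simp add: algebra_simps)
  qed auto
  from this[of "t div N"] show ?thesis by simp
qed

subsection \<open>Periodic sequences\<close>

text \<open>In terms of lambda lengths, with boundary edges of length 1, the summands are the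
  h-lengths at the puncture.\<close>

definition recips :: "(int \<Rightarrow> int) \<Rightarrow> int \<Rightarrow> nat \<Rightarrow> real" where
  "recips c q j = (\<Sum>l<j. 1 / (real_of_int (c (q + int l)) * real_of_int (c (q + int l + 1))))"

definition farey_cycles :: "nat \<Rightarrow> (int \<Rightarrow> int) set" where
  "farey_cycles N = {c. (\<forall>i. 0 < c i) \<and> (\<forall>i. c (i + int N) = c i) \<and>
     (\<forall>i. c i dvd c (i - 1) + c (i + 1)) \<and> (\<forall>q. recips c q N = 1)}"

definition farey_cycles_min :: "nat \<Rightarrow> nat \<Rightarrow> (int \<Rightarrow> int) set" where
  "farey_cycles_min N m =
     {c \<in> farey_cycles N. (\<exists>i. c i = int m) \<and> (\<forall>i. int m \<le> c i)}"

text \<open>A block of \<open>k\<close> letters \<open>m\<close> after an \<open>m\<close> has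
  reciprocal sum \<open>k / m^2\<close>; the total 1 forces \<open>k = m^2\<close>.\<close>

definition min_words :: "nat \<Rightarrow> nat \<Rightarrow> int list set" where
  "min_words N m = {w. farey_word (int m) (replicate (m\<^sup>2) (int m)) w \<and> length w = N}"

lemma card_min_words:
  assumes "0 < m"
  shows "finite (min_words N m)"
    and "int (card (min_words N m)) = (if m\<^sup>2 \<le> N then ballot (m\<^sup>2) (N - m\<^sup>2) else 0)"
proof -
  have "min_words N m = (if m\<^sup>2 \<le> N then farey_words m (replicate (m\<^sup>2) (int m)) (N - m\<^sup>2) else {})"
    by (auto simp: min_words_def farey_words_def dest!: farey_word_length)
  with card_farey_words[of m "replicate (m\<^sup>2) (int m)" "N - m\<^sup>2"] assms
  show "finite (min_words N m)"
    "int (card (min_words N m)) = (if m\<^sup>2 \<le> N then ballot (m\<^sup>2) (N - m\<^sup>2) else 0)"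
    by auto
qed

text \<open>A list that closes up at index \<open>N\<close> can be read cyclically with no case
  distinction at the end of the period.\<close>

lemma nth_mod_Suc:
  fixes e :: "'a list"
  assumes "0 < N" "e ! N = e ! 0"
  shows "e ! nat ((t + 1) mod int N) = e ! Suc (nat (t mod int N))"
proof -
  have r: "0 \<le> t mod int N" "t mod int N < int N" using assms by auto
  have "(t + 1) mod int N = (t mod int N + 1) mod int N" by (simp add: mod_simps)
  moreover have "\<dots> = (if t mod int N + 1 = int N then 0 else t mod int N + 1)"
    using r by auto
  moreover have "Suc (nat (t mod int N)) = N" if "t mod int N + 1 = int N"
    using that r by linarith
  ultimately show ?thesis using r assms by (auto simp: nat_add_distrib simp del: mod_add_right_eq split: if_splits)
qed

text \<open>The word starts at \<open>c 1\<close>, as \<open>c 0\<close> is the letter from which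
  the parser starts. It ends with \<open>c N\<close>, which is again \<open>c 0\<close> when
  \<open>c\<close> has period \<open>N\<close>.\<close>

definition cycle_word :: "nat \<Rightarrow> (int \<Rightarrow> int) \<Rightarrow> int list" where
  "cycle_word N c = map (\<lambda>l. c (int l + 1)) [0..<N]"

lemma nth_Cons_cycle_word: "i \<le> N \<Longrightarrow> (c 0 # cycle_word N c) ! i = c (int i)"
  by (cases i) (auto simp: cycle_word_def add.commute)

text \<open>Divisibility yields a parse from some number \<open>k\<close> of pending letters
  \<open>m\<close>, and the invariance of the reciprocal sum gives \<open>k = m^2\<close>.\<close>

lemma cycle_word_in_min_words:
  assumes "0 < N" "0 < m" "c \<in> farey_cycles_min N m" "c 0 = m"
  shows "cycle_word N c \<in> min_words N m"
proof -
  define w where "w = cycle_word N c"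
  have c: "\<And>i. 0 < c i" "\<And>i. c (i + int N) = c i" "\<And>i. c i dvd c (i - 1) + c (i + 1)"
    "recips c 0 N = 1" "\<And>i. m \<le> c i"
    using assms by (auto simp: farey_cycles_min_def farey_cycles_def)
  have nth: "(int m # w) ! i = c (int i)" if "i \<le> N" for i
    using nth_Cons_cycle_word[OF that, of c] assms(4) by (simp add: w_def)
  have len: "length w = N" by (simp add: w_def cycle_word_def)
  have "dvd_chain (int m # w)"
    unfolding dvd_chain_iff_nth
  proof (intro allI impI)
    fix i assume i: "i + 2 < length (int m # w)"
    then show "(int m # w) ! Suc i dvd (int m # w) ! i + (int m # w) ! (i + 2)"
      using nth[of i] nth[of "Suc i"] nth[of "i + 2"] c(3)[of "int i + 1"] len
      by (simp add: add.commute del: nth_Cons_Suc add_2_eq_Suc add_2_eq_Suc')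
  qed
  moreover have "\<forall>x\<in>set w. m \<le> x" using c(5) by (auto simp: w_def cycle_word_def)
  moreover have "w \<noteq> []" using assms(1) len by auto
  moreover have "last w = m"
    using nth[of N] c(2)[of 0] assms(1,4) len \<open>w \<noteq> []\<close> by (auto simp: last_conv_nth nth_Cons')
  ultimately obtain k where k: "farey_word (int m) (replicate k (int m)) w"
    using dvd_chain_imp_farey_word[of m w] assms by auto
  have "recip_sum (int m # w) = recips c 0 N"
    unfolding recip_sum_conv_nth recips_def
  proof (intro sum.cong)
    fix i assume "i \<in> {..<N}"
    then show "1 / (real_of_int ((int m # w) ! i) * real_of_int ((int m # w) ! Suc i)) =
        1 / (real_of_int (c (0 + int i)) * real_of_int (c (0 + int i + 1)))"
      using nth[of i] nth[of "Suc i"] by (simp add: add.commute del: nth_Cons_Suc)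
  qed (simp add: len)
  moreover have "recip_sum (int m # w) = real k / (real m)\<^sup>2"
    using farey_word_recip_sum[OF k] assms recip_sum_replicate[of "int m" k] by simp
  ultimately have "real k / (real m)\<^sup>2 = 1" using c(4) by simp
  then have "real k = real (m\<^sup>2)" using assms by (simp add: field_simps)
  then have "k = m\<^sup>2" by (metis of_nat_eq_iff)
  with k len show ?thesis by (simp add: min_words_def w_def)
qed

text \<open>The word is repeated periodically. Inside a period, divisibility is the chain condition;
  at the seam the entry is \<open>m\<close>, which divides every letter.\<close>

lemma min_words_imp_cycle:
  fixes N m :: nat
  assumes "0 < N" "0 < m" "w \<in> min_words N m"
  defines "c \<equiv> \<lambda>t. (int m # w) ! nat (t mod int N)"
  shows "c \<in> farey_cycles_min N m" "c 0 = m" "cycle_word N c = w"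
proof -
  define e where "e = int m # w"
  have w: "farey_word (int m) (replicate (m\<^sup>2) (int m)) w" "length w = N"
    using assms by (auto simp: min_words_def)
  have "w \<noteq> []" using w assms by auto
  moreover have "last w = m" using farey_word_last[OF w(1)] assms by simp
  ultimately have wrap: "e ! N = e ! 0"
    using w by (auto simp: e_def last_conv_nth nth_Cons')
  have c0: "c t = e ! nat (t mod int N)" for t by (simp add: c_def e_def)
  have c1: "c (t + 1) = e ! Suc (nat (t mod int N))" for t
    unfolding c0 using wrap assms(1) by (intro nth_mod_Suc)
  have r: "nat (t mod int N) < N" for t using assms(1) by (simp add: nat_less_iff)
  have "\<forall>x\<in>set w. m \<le> x" "\<forall>x\<in>set w. int m dvd x"
    using farey_word_lower_bound[OF w(1)] farey_word_dvd[OF w(1)] assms by auto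
  then have "\<forall>x\<in>set e. m \<le> x \<and> m dvd x" by (simp add: e_def)
  moreover have "c t \<in> set e" for t
    using r[of t] w unfolding c0 e_def by (intro nth_mem) simp
  ultimately have ge: "m \<le> c t" and dvd: "m dvd c t" for t by blast+
  have per: "c (t + int N) = c t" for t by (simp add: c0)
  have "dvd_chain e"
    unfolding e_def
  proof (intro farey_word_dvd_chain[OF w(1)])
    show "dvd_chain (int m # replicate (m\<^sup>2) (int m))"
      by (auto simp: dvd_chain_iff_nth nth_Cons')
  qed (use assms(2) in auto)
  then have "c t dvd c (t - 1) + c (t + 1)" for t
  proof (cases "Suc (nat ((t - 1) mod int N)) < N")
    case True
    \<comment> \<open>The successor rule for the index itself is the instance of
      \<open>nth_mod_Suc\<close> for the list of indices, closed up by a 0.\<close>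
    then have "nat (t mod int N) = Suc (nat ((t - 1) mod int N))"
      using nth_mod_Suc[of N "[0..<N] @ [0]" "t - 1"] r[of t] by (simp add: nth_append)
    then show ?thesis
      using \<open>dvd_chain e\<close> c1[of t] c1[of "t - 1"] c0[of "t - 1"] True w
      unfolding dvd_chain_iff_nth by (auto simp: e_def)
  next
    case False
    then have "Suc (nat ((t - 1) mod int N)) = N" using r[of "t - 1"] by simp
    then have "c t = m" using c1[of "t - 1"] wrap by (simp add: e_def)
    then show ?thesis using dvd by simp
  qed
  moreover have "recips c q N = 1" for q
  proof -
    have "c (i + int N + 1) = c (i + 1)" for i
      using per[of "i + 1"] by (simp add: add_ac)
    then have step: "1 / (real_of_int (c (i + int N)) * real_of_int (c (i + int N + 1))) =
        1 / (real_of_int (c i) * real_of_int (c (i + 1)))" for i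
      by (simp add: per)
    have "recips c q N = recips c 0 N"
      unfolding recips_def
      using sum_window_periodic[of "\<lambda>i. 1 / (real_of_int (c i) * real_of_int (c (i + 1)))" N q, OF step]
      by simp
    also have "\<dots> = recip_sum e"
      unfolding recips_def recip_sum_conv_nth
    proof (intro sum.cong)
      fix i assume "i \<in> {..<length e - 1}"
      then have "nat (int i mod int N) = i" using w by (simp add: e_def)
      then show "1 / (real_of_int (c (0 + int i)) * real_of_int (c (0 + int i + 1))) =
          1 / (real_of_int (e ! i) * real_of_int (e ! Suc i))"
        using c0[of "int i"] c1[of "int i"] by simp
    qed (use w in \<open>simp add: e_def\<close>)
    also have "\<dots> = 1"
      using farey_word_recip_sum[OF w(1)] assms(2) by (simp add: e_def recip_sum_replicate)
    finally show ?thesis .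
  qed
  moreover have "0 < c t" for t using ge[of t] assms(2) by linarith
  moreover show "c 0 = m" by (simp add: c_def)
  ultimately show "c \<in> farey_cycles_min N m"
    using ge per by (auto simp: farey_cycles_min_def farey_cycles_def)
  show "cycle_word N c = w"
    by (rule nth_equalityI) (use w in \<open>auto simp: cycle_word_def c1 e_def\<close>)
qed

lemma bij_betw_cycle_word:
  assumes "0 < N" "0 < m"
  shows "bij_betw (cycle_word N) {c \<in> farey_cycles_min N m. c 0 = m} (min_words N m)"
proof (rule bij_betwI[where g = "\<lambda>w t. (int m # w) ! nat (t mod int N)"])
  show "cycle_word N \<in> {c \<in> farey_cycles_min N m. c 0 = m} \<rightarrow> min_words N m"
    using cycle_word_in_min_words assms by auto
  show "(\<lambda>w t. (int m # w) ! nat (t mod int N)) \<in>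
      min_words N m \<rightarrow> {c \<in> farey_cycles_min N m. c 0 = m}"
    using min_words_imp_cycle assms by auto
  show "cycle_word N (\<lambda>t. (int m # w) ! nat (t mod int N)) = w" if "w \<in> min_words N m" for w
    using min_words_imp_cycle assms that by auto
  show "(\<lambda>t. (int m # cycle_word N c) ! nat (t mod int N)) = c"
    if "c \<in> {c \<in> farey_cycles_min N m. c 0 = m}" for c
  proof
    fix t
    have "nat (t mod int N) \<le> N" using assms(1) by (simp add: nat_le_iff order_less_imp_le)
    moreover have "c (t mod int N) = c t"
      using that by (intro periodic_mod) (auto simp: farey_cycles_min_def farey_cycles_def)
    ultimately show "(int m # cycle_word N c) ! nat (t mod int N) = c t"
      using nth_Cons_cycle_word[of "nat (t mod int N)" N c] that assms(1) by simp
  qed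
qed

section \<open>Rotations and the double count\<close>

lemma farey_cycles_shift:
  "c \<in> farey_cycles_min N m \<Longrightarrow> (\<lambda>t. c (t + i)) \<in> farey_cycles_min N m"
proof -
  assume c: "c \<in> farey_cycles_min N m"
  obtain j where "c j = m" using c by (auto simp: farey_cycles_min_def)
  then have "\<exists>t. c (t + i) = m" by (intro exI[of _ "j - i"]) simp
  moreover have "recips (\<lambda>t. c (t + i)) q N = recips c (q + i) N" for q
    by (simp add: recips_def algebra_simps)
  moreover have "c (t + i) dvd c (t - 1 + i) + c (t + 1 + i)" for t
    using c by (auto simp: farey_cycles_min_def farey_cycles_def algebra_simps
      dest!: spec[of "\<lambda>x. c x dvd c (x - 1) + c (x + 1)" "t + i"])
  moreover have "c (t + int N + i) = c (t + i)" for t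
    using c by (auto simp: farey_cycles_min_def farey_cycles_def algebra_simps
      dest!: spec[of "\<lambda>x. c (x + int N) = c x" "t + i"])
  ultimately show ?thesis
    using c by (auto simp: farey_cycles_min_def farey_cycles_def)
qed

lemma count_list_conv_sum: "count_list xs y = (\<Sum>i<length xs. of_bool (xs ! i = y))"
  by (induction xs) (auto simp: sum.lessThan_Suc_shift simp del: sum.lessThan_Suc)

text \<open>Once a minimum is rotated to position 0, the letters \<open>m\<close> of the word are
  just the \<open>m^2\<close> initial ones. The count over a period does not depend on where the
  period begins.\<close>

lemma card_min_positions:
  assumes "0 < N" "0 < m" "c \<in> farey_cycles_min N m"
  shows "card {i. i < N \<and> c (int i) = m} = m\<^sup>2"
proof -
  obtain j where j: "c j = m" using assms by (auto simp: farey_cycles_min_def)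
  define d where "d = (\<lambda>t. c (t + j))"
  have "cycle_word N d \<in> min_words N m"
    using assms j farey_cycles_shift by (intro cycle_word_in_min_words) (auto simp: d_def)
  then have "count_list (cycle_word N d) m = m\<^sup>2"
    using farey_word_count_min[of m "replicate (m\<^sup>2) (int m)" "cycle_word N d" m] assms(2)
    by (auto simp: min_words_def count_list_conv_sum[of "replicate _ _"])
  moreover have "count_list (cycle_word N d) m = (\<Sum>l<N. of_bool (c (j + 1 + int l) = m))"
    by (auto simp: count_list_conv_sum cycle_word_def d_def algebra_simps intro!: sum.cong)
  ultimately have "int (m\<^sup>2) = (\<Sum>l<N. of_bool (c (j + 1 + int l) = m))"
    by simp
  also have "\<dots> = (\<Sum>l<N. of_bool (c (int l) = m))"
    using assms(3)
    by (intro sum_window_periodic[of "\<lambda>i. of_bool (c i = m)"])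
      (auto simp: farey_cycles_min_def farey_cycles_def)
  also have "\<dots> = int (card {i. i < N \<and> c (int i) = m})"
    by (simp add: Collect_conj_eq lessThan_def)
  finally show ?thesis by simp
qed

text \<open>Double counting of the pairs of a sequence and a position of its minimum: rotating that
  position to 0 leaves a word and an arbitrary amount of rotation.\<close>

lemma card_farey_cycles_min:
  assumes "0 < N" "0 < m"
  shows "finite (farey_cycles_min N m)"
    and "m\<^sup>2 * card (farey_cycles_min N m) = N * card (min_words N m)"
proof -
  define P where "P = (SIGMA c:farey_cycles_min N m. {i. i < N \<and> c (int i) = m})"
  define Z where "Z = {c \<in> farey_cycles_min N m. c 0 = m}"
  have Z: "finite Z" "card Z = card (min_words N m)"
    using bij_betw_cycle_word[OF assms] card_min_words(1)[OF assms(2)]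
    by (auto simp: Z_def bij_betw_finite bij_betw_same_card)
  have bij: "bij_betw (\<lambda>(c, i). (\<lambda>t. c (t + int i), i)) P (Z \<times> {..<N})"
    by (rule bij_betwI[where g = "\<lambda>(c, i). (\<lambda>t. c (t + - int i), i)"])
      (auto simp: P_def Z_def farey_cycles_shift simp del: add_uminus_conv_diff)
  have "finite P" using bij Z bij_betw_finite by blast
  moreover have "farey_cycles_min N m \<subseteq> fst ` P"
  proof
    fix c assume c: "c \<in> farey_cycles_min N m"
    then have "{i. i < N \<and> c (int i) = m} \<noteq> {}"
      using card_min_positions[OF assms c] assms by fastforce
    then show "c \<in> fst ` P" using c by (force simp: P_def)
  qed
  ultimately show fin: "finite (farey_cycles_min N m)"
    using finite_surj by blast
  have "card P = m\<^sup>2 * card (farey_cycles_min N m)"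
    using fin card_min_positions[OF assms] by (simp add: P_def)
  moreover have "card P = card Z * N"
    using bij_betw_same_card[OF bij] by (simp add: card_cartesian_product)
  ultimately show "m\<^sup>2 * card (farey_cycles_min N m) = N * card (min_words N m)"
    using Z by (simp add: mult.commute)
qed

text \<open>Here \<open>n + 1 = s + m^2\<close> with \<open>s\<close> the number of mediants, so
  \<open>ballot_mult\<close> applies to the double count and \<open>m^2\<close> cancels. Symmetry of
  the binomial coefficient turns \<open>choose s\<close> into \<open>choose n\<close>.\<close>

lemma card_farey_cycles_min_eq:
  assumes "0 < m" "1 \<le> n"
  shows "card (farey_cycles_min (n + 1) m) =
    (if m\<^sup>2 \<le> n + 1 then (2 * n - m\<^sup>2 + 1) choose n else 0)"
proof (cases "m\<^sup>2 \<le> n + 1")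
  case True
  define s where "s = n + 1 - m\<^sup>2"
  have n: "n + 1 = s + m\<^sup>2" using True by (simp add: s_def)
  have m2: "0 < m\<^sup>2" using assms by simp
  have "int (m\<^sup>2 * card (farey_cycles_min (n + 1) m)) = int (n + 1) * int (card (min_words (n + 1) m))"
    using card_farey_cycles_min(2)[of "n + 1" m] assms by (metis of_nat_mult zero_less_Suc Suc_eq_plus1)
  also have "\<dots> = int (s + m\<^sup>2) * ballot (m\<^sup>2) s"
    using card_min_words(2)[OF assms(1), of "n + 1"] True n by (simp add: s_def)
  also have "\<dots> = int (m\<^sup>2 * ((2 * s + m\<^sup>2 - 1) choose s))"
    using ballot_mult[OF m2] by simp
  finally have "card (farey_cycles_min (n + 1) m) = (2 * s + m\<^sup>2 - 1) choose s"
    using m2 by (metis mult_left_cancel neq0_conv of_nat_eq_iff)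
  also have "\<dots> = (2 * s + m\<^sup>2 - 1) choose (2 * s + m\<^sup>2 - 1 - s)"
    using m2 by (intro binomial_symmetric) linarith
  also have "2 * s + m\<^sup>2 - 1 - s = n" using n by linarith
  also have "2 * s + m\<^sup>2 - 1 = 2 * n - m\<^sup>2 + 1" using n m2 assms(2) by linarith
  finally show ?thesis using True by simp
next
  case False
  then show ?thesis
    using card_farey_cycles_min(2)[of "n + 1" m] card_min_words(2)[OF assms(1), of "n + 1"] assms
    by auto
qed

text \<open>Sequences are sorted by their minimum \<open>m\<close>. The bound on \<open>m\<close>
  comes from the count itself: a nonempty finite class has positive cardinality, whereas the formula
  gives 0 if \<open>m^2 > n + 1\<close>.\<close>

lemma farey_cycles_eq_Union:
  assumes "1 \<le> n"
  shows "farey_cycles (n + 1) = (\<Union>m\<in>{m. 1 \<le> m \<and> real m \<le> sqrt (real (n + 1))}. farey_cycles_min (n + 1) m)"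
proof (intro equalityI subsetI)
  fix c assume c: "c \<in> farey_cycles (n + 1)"
  obtain j where j: "\<And>i. nat (c j) \<le> nat (c i)"
    using ex_has_least_nat[of "\<lambda>_. True" 0 "\<lambda>i. nat (c i)"] by auto
  define m where "m = nat (c j)"
  have pos: "0 < c i" for i using c by (simp add: farey_cycles_def)
  have "c \<in> farey_cycles_min (n + 1) m" "0 < m"
    using c j pos by (auto simp: farey_cycles_min_def m_def le_nat_iff less_imp_le nat_le_eq_zle intro!: exI[of _ j])
  moreover from this have "card (farey_cycles_min (n + 1) m) > 0"
    using card_farey_cycles_min(1)[of "n + 1" m] by (auto simp: card_gt_0_iff)
  then have "m\<^sup>2 \<le> n + 1"
    using card_farey_cycles_min_eq[OF \<open>0 < m\<close> assms] by (simp split: if_splits)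
  then have "real m \<le> sqrt (real (n + 1))"
    by (metis of_nat_le_iff of_nat_power real_le_rsqrt)
  ultimately show "c \<in> (\<Union>m\<in>{m. 1 \<le> m \<and> real m \<le> sqrt (real (n + 1))}. farey_cycles_min (n + 1) m)"
    by (auto simp: Suc_le_eq)
qed (auto simp: farey_cycles_min_def)

lemma card_farey_cycles:
  assumes "1 \<le> n"
  shows "card (farey_cycles (n + 1)) =
    (\<Sum>m :: nat | 1 \<le> m \<and> real m \<le> sqrt (real (n + 1)). (2 * n - m ^ 2 + 1) choose n)"
proof -
  define A where "A = {m. 1 \<le> m \<and> real m \<le> sqrt (real (n + 1))}"
  have sq: "m\<^sup>2 \<le> n + 1" if "m \<in> A" for m
    using that by (metis (mono_tags, lifting) A_def mem_Collect_eq of_nat_le_iff of_nat_power sqrt_ge_absD abs_of_nat)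
  have "m \<le> n + 1" if "m \<in> A" for m :: nat
    using sq[OF that] self_le_power[of m 2] that by (simp add: A_def)
  then have "finite A" by (intro finite_subset[of A "{..n + 1}"]) auto
  moreover have "farey_cycles_min (n + 1) m \<inter> farey_cycles_min (n + 1) k = {}" if "m \<noteq> k" for m k :: nat
  proof -
    have "k = m" if c: "c \<in> farey_cycles_min (n + 1) m" "c \<in> farey_cycles_min (n + 1) k" for c
      using c by (auto simp: farey_cycles_min_def) (metis of_nat_le_iff order_antisym)
    then show ?thesis using that by blast
  qed
  ultimately have "card (farey_cycles (n + 1)) = (\<Sum>m\<in>A. card (farey_cycles_min (n + 1) m))"
    unfolding farey_cycles_eq_Union[OF assms] A_def[symmetric]
    by (intro card_UN_disjoint) (auto simp: A_def intro: card_farey_cycles_min(1))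
  also have "\<dots> = (\<Sum>m\<in>A. (2 * n - m\<^sup>2 + 1) choose n)"
    using sq assms card_farey_cycles_min_eq[of _ n] by (intro sum.cong refl) (simp add: A_def)
  finally show ?thesis by (simp add: A_def)
qed

subsection \<open>The last row of a frieze\<close>

text \<open>The relations for the orientation 1 -> 2 -> ... -> n. Values outside the rows 1 to
  \<open>n\<close> are left free.\<close>

definition friezes_B :: "nat \<Rightarrow> (nat \<Rightarrow> int \<Rightarrow> int) set" where
  "friezes_B n = {b. (\<forall>j\<in>{1..n}. \<forall>m. 0 < b j m \<and>
     b j m * b j (m + 1) = 1 + (if j = 1 then 1 else b (j - 1) (m + 1)) *
       (if j = n then 1 else b (j + 1) m ^ (if j + 1 = n then 2 else 1)))}"

section \<open>Partial sums of reciprocals and the rows of a frieze\<close>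

lemma recips_0 [simp]: "recips c q 0 = 0"
  by (simp add: recips_def)

lemma recips_Suc: "recips c q (Suc j) =
    recips c q j + 1 / (real_of_int (c (q + int j)) * real_of_int (c (q + int j + 1)))"
  by (simp add: recips_def)

lemma recips_Suc_shift: "recips c q (Suc j) =
    1 / (real_of_int (c q) * real_of_int (c (q + 1))) + recips c (q + 1) j"
proof (induction j)
  case (Suc j)
  have "q + int (Suc j) = q + 1 + int j" by simp
  then show ?case using Suc recips_Suc[of c q "Suc j"] recips_Suc[of c "q + 1" j] by (simp add: add.assoc)
qed (simp add: recips_Suc)

lemma recips_nonneg: "(\<And>i. 0 < c i) \<Longrightarrow> 0 \<le> recips c q j"
  unfolding recips_def by (intro sum_nonneg) (simp add: less_imp_le)

text \<open>The row \<open>n\<close> is replaced by its squares and a row of ones is added: this extends \<open>b\<close> to an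
  array in which every \<open>2 \<times> 2\<close> diamond has determinant 1.\<close>

definition squared_frieze :: "nat \<Rightarrow> (nat \<Rightarrow> int \<Rightarrow> int) \<Rightarrow> nat \<Rightarrow> int \<Rightarrow> int" where
  "squared_frieze n b j m = (if j = 0 then 1 else if j = n then (b n m)\<^sup>2 else b j m)"

lemma friezes_B_pos: "b \<in> friezes_B n \<Longrightarrow> 0 < j \<Longrightarrow> j \<le> n \<Longrightarrow> 0 < b j m"
  by (auto simp: friezes_B_def)

lemma friezes_B_relation:
  assumes "b \<in> friezes_B n" "0 < j" "j \<le> n"
  shows "b j m * b j (m + 1) = 1 + (if j = 1 then 1 else b (j - 1) (m + 1)) *
    (if j = n then 1 else b (j + 1) m ^ (if j + 1 = n then 2 else 1))"
proof -
  have "j \<in> {1..n}" using assms by auto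
  then show ?thesis using assms(1) unfolding friezes_B_def by blast
qed

lemma squared_frieze_pos:
  assumes "b \<in> friezes_B n" "j \<le> n"
  shows "0 < squared_frieze n b j m"
  using friezes_B_pos[OF assms(1), of j m] assms(2) by (auto simp: squared_frieze_def)

lemma squared_frieze_diamond:
  assumes "b \<in> friezes_B n" "1 \<le> j" "j < n"
  shows "squared_frieze n b j m * squared_frieze n b j (m + 1) =
    1 + squared_frieze n b (j - 1) (m + 1) * squared_frieze n b (j + 1) m"
  using friezes_B_relation[OF assms(1), of j m] assms(2,3) by (auto simp: squared_frieze_def)

lemma squared_frieze_top:
  assumes "b \<in> friezes_B n" "1 \<le> n"
  shows "squared_frieze n b (n - 1) (m + 1) = b n m * b n (m + 1) - 1"
  using friezes_B_relation[OF assms(1), of n m] assms(2) by (auto simp: squared_frieze_def)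

text \<open>With \<open>u\<close> and \<open>v\<close> the two reciprocals, this is
  \<open>T (T + v - u) = (T - u) (T + v) + u v\<close> times \<open>p p' q q'\<close>. It is the
  diamond relation for entries given by partial reciprocal sums, used both to analyse and to
  construct friezes.\<close>

lemma diamond_reciprocals:
  fixes p p' q q' T :: real
  assumes "p \<noteq> 0" "p' \<noteq> 0" "q \<noteq> 0" "q' \<noteq> 0"
  shows "(p * q * T) * (p' * q' * (T + 1 / (q * q') - 1 / (p * p'))) =
    1 + (p' * q * (T - 1 / (p * p'))) * (p * q' * (T + 1 / (q * q')))"
proof -
  define u v where "u = 1 / (p * p')" and "v = 1 / (q * q')"
  have "p * p' * u * (q * q' * v) = 1" using assms by (simp add: u_def v_def)
  then show ?thesis unfolding u_def[symmetric] v_def[symmetric] by (simp add: algebra_simps)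
qed

text \<open>Induction away from the last row: distance 0 is the square, distance 1 the relation at
  the vertex \<open>n\<close>, and each further row follows from the two before it by a diamond. The
  factor \<open>1 - recips\<close> stands for the part of a full turn complementary to the steps
  from \<open>q\<close> to \<open>q + i\<close>.\<close>

lemma squared_frieze_conv_recips:
  assumes b: "b \<in> friezes_B n" and "1 \<le> n" "i \<le> n"
  shows "squared_frieze n b (n - i) (q + int i) =
    real_of_int (b n q) * real_of_int (b n (q + int i)) * (1 - recips (b n) q i)"
  using assms(3)
proof (induction i arbitrary: q rule: less_induct)
  case (less i)
  have pos: "0 < b n m" for m using b assms(2) by (simp add: friezes_B_def)
  then have nz: "real_of_int (b n m) \<noteq> 0" for m by (metis less_irrefl of_int_eq_0_iff)
  consider "i = 0" | "i = 1" | k where "i = k + 2" by (metis One_nat_def add_2_eq_Suc' not0_implies_Suc)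
  then show ?case
  proof cases
    case 1
    then show ?thesis using assms(2) by (simp add: squared_frieze_def power2_eq_square)
  next
    case 2
    then show ?thesis
      using squared_frieze_top[OF b assms(2), of q] nz
      by (simp add: recips_def right_diff_distrib mult.commute)
  next
    case 3
    let ?f = "\<lambda>j m. real_of_int (squared_frieze n b j m)"
    let ?c = "\<lambda>m. real_of_int (b n m)"
    define p where "p = q + 1 + int k"
    define T where "T = 1 - recips (b n) q (k + 1)"
    let ?g = "squared_frieze n b"
    have "?g (n - (k + 1)) p * ?g (n - (k + 1)) (p + 1) =
        1 + ?g (n - (k + 1) - 1) (p + 1) * ?g (n - (k + 1) + 1) p"
      by (rule squared_frieze_diamond[OF b]) (use 3 less.prems in auto)
    moreover have idx: "n - (k + 1) + 1 = n - k" "n - (k + 1) - 1 = n - i" "p + 1 = q + int i"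
      using 3 less.prems by (auto simp: p_def)
    ultimately have "?g (n - (k + 1)) p * ?g (n - (k + 1)) (p + 1) =
        1 + ?g (n - i) (p + 1) * ?g (n - k) p"
      by (simp only:)
    from arg_cong[OF this, of real_of_int]
    have E: "?f (n - (k + 1)) p * ?f (n - (k + 1)) (p + 1) = 1 + ?f (n - i) (p + 1) * ?f (n - k) p"
      by (simp only: of_int_1 of_int_add of_int_mult)
    have f1: "?f (n - (k + 1)) p = ?c p * ?c q * T"
      using less.IH[of "k + 1" q] 3 less.prems by (simp add: p_def T_def add_ac)
    have f2: "?f (n - (k + 1)) (p + 1) =
        ?c (p + 1) * ?c (q + 1) * (T + 1 / (?c q * ?c (q + 1)) - 1 / (?c p * ?c (p + 1)))"
      using less.IH[of "k + 1" "q + 1"] 3 less.prems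
        recips_Suc[of "b n" "q + 1" k] recips_Suc_shift[of "b n" q k]
      by (simp add: p_def T_def add_ac)
    have f3: "?f (n - k) p = ?c p * ?c (q + 1) * (T + 1 / (?c q * ?c (q + 1)))"
      using less.IH[of k "q + 1"] 3 less.prems recips_Suc_shift[of "b n" q k]
      by (simp add: p_def T_def add_ac)
    have "1 + ?f (n - i) (p + 1) * ?f (n - k) p =
        1 + (?c (p + 1) * ?c q * (T - 1 / (?c p * ?c (p + 1)))) * ?f (n - k) p"
      using E diamond_reciprocals[OF nz[of p] nz[of "p + 1"] nz[of q] nz[of "q + 1"], of T] unfolding f1 f2 f3
      by (rule trans[OF sym])
    then have "?f (n - i) (p + 1) * ?f (n - k) p =
        (?c (p + 1) * ?c q * (T - 1 / (?c p * ?c (p + 1)))) * ?f (n - k) p"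
      by (rule add_left_imp_eq)
    \<comment> \<open>Positivity allows the diamond to be solved for the new entry.\<close>
    moreover have "?f (n - k) p \<noteq> 0"
      using squared_frieze_pos[OF b, of "n - k" p] by simp
    ultimately have "?f (n - i) (p + 1) = ?c (p + 1) * ?c q * (T - 1 / (?c p * ?c (p + 1)))"
      by simp
    moreover have "T - 1 / (?c p * ?c (p + 1)) = 1 - recips (b n) q i"
      using recips_Suc[of "b n" q "k + 1"] 3 by (simp add: p_def T_def add_ac)
    ultimately show ?thesis
      using \<open>p + 1 = q + int i\<close> by (simp add: mult.commute)
  qed
qed

text \<open>The formula for row 0, which consists of ones, leads to the sum and then to the period;
  row 1 gives the divisibility.\<close>

lemma frieze_last_row_in_farey_cycles:
  assumes b: "b \<in> friezes_B n" and n: "1 \<le> n"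
  shows "b n \<in> farey_cycles (n + 1)"
proof -
  let ?c = "\<lambda>m. real_of_int (b n m)"
  have pos: "0 < b n m" for m using b n by (simp add: friezes_B_def)
  then have nz: "?c m \<noteq> 0" for m by (metis less_irrefl of_int_eq_0_iff)
  have unit: "?c q * ?c (q + int n) * (1 - recips (b n) q n) = 1" for q
    using squared_frieze_conv_recips[OF b n order_refl, of q] by (simp add: squared_frieze_def)
  have sum: "recips (b n) q (n + 1) = 1" for q
  proof -
    define k where "k = n - 1"
    have k: "n = Suc k" using n by (simp add: k_def)
    define p where "p = q + int n"
    define T where "T = 1 - recips (b n) q n"
    have "?c p * ?c q * T = 1" using unit[of q] by (simp add: p_def T_def mult_ac)
    moreover have T1: "T + 1 / (?c q * ?c (q + 1)) - 1 / (?c p * ?c (p + 1)) = 1 - recips (b n) (q + 1) n"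
      using recips_Suc[of "b n" "q + 1" k] recips_Suc_shift[of "b n" q k]
      by (simp add: p_def T_def k add_ac)
    moreover have "?c (p + 1) * ?c (q + 1) * (1 - recips (b n) (q + 1) n) = 1"
      using unit[of "q + 1"] by (simp add: p_def mult_ac add_ac)
    \<comment> \<open>Two consecutive ones in row 0 make the opposite product of the diamond vanish.
      The second factor is a positive entry of row 1; the first is an entry of a fictitious row -1,
      with \<open>1 - recips\<close> taken over \<open>n + 1\<close> steps.\<close>
    ultimately have "(?c (p + 1) * ?c q * (T - 1 / (?c p * ?c (p + 1)))) *
        (?c p * ?c (q + 1) * (T + 1 / (?c q * ?c (q + 1)))) = 0"
      using diamond_reciprocals[of "?c p" "?c (p + 1)" "?c q" "?c (q + 1)" T] nz by simp
    moreover have "?c p * ?c (q + 1) * (T + 1 / (?c q * ?c (q + 1))) =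
        squared_frieze n b (n - k) (q + 1 + int k)"
      using squared_frieze_conv_recips[OF b n, of k "q + 1"] recips_Suc_shift[of "b n" q k]
      by (simp add: p_def T_def k add_ac mult_ac)
    then have "?c p * ?c (q + 1) * (T + 1 / (?c q * ?c (q + 1))) \<noteq> 0"
      using squared_frieze_pos[OF b, of "n - k" "q + 1 + int k"] by simp
    ultimately have "T - 1 / (?c p * ?c (p + 1)) = 0" using nz by simp
    then show ?thesis using recips_Suc[of "b n" q n] by (simp add: p_def T_def)
  qed
  have per: "b n (q + int (n + 1)) = b n q" for q
  proof -
    have "1 - recips (b n) q n = 1 / (?c (q + int n) * ?c (q + int n + 1))"
      using sum[of q] recips_Suc[of "b n" q n] by simp
    then have "?c q * ?c (q + int n) * (1 / (?c (q + int n) * ?c (q + int n + 1))) = 1"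
      using unit[of q] by simp
    then have "?c q = ?c (q + int n + 1)" using nz by (simp add: field_simps)
    then show ?thesis by (simp add: add_ac)
  qed
  have dvd: "b n q dvd b n (q - 1) + b n (q + 1)" for q
  proof -
    define k where "k = n - 1"
    have k: "n = Suc k" using n by (simp add: k_def)
    \<comment> \<open>The entry of row 1 for the arc that cuts off the vertex \<open>q\<close>; it
      will be the quotient of the neighbour sum by \<open>b n q\<close>.\<close>
    define x where "x = squared_frieze n b (n - k) (q + 1 + int k)"
    have "recips (b n) (q - 1) 2 + recips (b n) (q + 1) k = 1"
      using sum[of "q - 1"] recips_Suc_shift[of "b n" "q - 1" n] recips_Suc_shift[of "b n" q k]
      by (simp add: k recips_def numeral_2_eq_2)
    then have "x = ?c (q + 1) * ?c (q + 1 + int k) * recips (b n) (q - 1) 2"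
      using squared_frieze_conv_recips[OF b n, of k "q + 1"] k by (simp add: x_def)
    also have "q + 1 + int k = q - 1 + int (n + 1)" using k by simp
    also have "?c (q - 1 + int (n + 1)) = ?c (q - 1)" by (simp only: per)
    also have "?c (q + 1) * ?c (q - 1) * recips (b n) (q - 1) 2 = (?c (q - 1) + ?c (q + 1)) / ?c q"
      using nz by (simp add: recips_def numeral_2_eq_2 field_simps)
    finally have "x * ?c q = ?c (q - 1) + ?c (q + 1)" using nz by (simp add: field_simps)
    then have "b n (q - 1) + b n (q + 1) = b n q * x"
      by (metis mult.commute of_int_add of_int_eq_iff of_int_mult)
    then show ?thesis by simp
  qed
  show ?thesis using pos per dvd sum by (simp add: farey_cycles_def)
qed

lemma frieze_determined_by_last_row:
  assumes b: "b \<in> friezes_B n" and b': "b' \<in> friezes_B n" and eq: "b n = b' n"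
    and "j \<in> {1..n}"
  shows "b j = b' j"
proof
  fix m
  have n: "1 \<le> n" using assms by simp
  let ?q = "m - int (n - j)"
  have "real_of_int (squared_frieze n b j m) = squared_frieze n b' j m"
    using squared_frieze_conv_recips[OF b n, of "n - j" ?q]
      squared_frieze_conv_recips[OF b' n, of "n - j" ?q] eq assms(4) by simp
  then show "b j m = b' j m"
    using assms(4) eq by (auto simp: squared_frieze_def split: if_splits)
qed

text \<open>In the once-punctured polygon, \<open>c\<close> gives the values of the arcs to the puncture, and \<open>(j, m)\<close> is
  the arc from \<open>m\<close> to \<open>m + j + 1\<close>; its value follows from the Ptolemy relations.\<close>

definition cycle_frieze :: "nat \<Rightarrow> (int \<Rightarrow> int) \<Rightarrow> nat \<Rightarrow> int \<Rightarrow> int" where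
  "cycle_frieze n c j m = (if j = n then c m
     else \<lfloor>real_of_int (c m) * real_of_int (c (m + int j + 1)) * recips c m (j + 1)\<rfloor>)"

text \<open>Writing \<open>y j\<close> for the value, \<open>y (k + 2) = x * y (k + 1) - y k\<close>
  with \<open>x\<close> the integer quotient at \<open>p = m + k + 1\<close>, starting from
  \<open>y 0 = 0\<close> and \<open>y 1 = 1\<close>. Hence the floor in \<open>cycle_frieze\<close>
  is exact.\<close>

lemma recips_integral:
  assumes pos: "\<And>i. 0 < c i" and dvd: "\<And>i. c i dvd c (i - 1) + c (i + 1)"
  shows "real_of_int (c m) * real_of_int (c (m + int j)) * recips c m j \<in> \<int>"
proof (induction j rule: less_induct)
  case (less j)
  have nz: "real_of_int (c i) \<noteq> 0" for i using pos[of i] by simp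
  consider "j = 0" | "j = 1" | k where "j = k + 2" by (metis One_nat_def add_2_eq_Suc' not0_implies_Suc)
  then show ?case
  proof cases
    case 2
    then show ?thesis using nz by (simp add: recips_def)
  next
    case 3
    define p where "p = m + int k + 1"
    obtain x where "c (p - 1) + c (p + 1) = c p * x" using dvd[of p] by (auto elim: dvdE)
    then have x: "real_of_int (c (p + 1)) = c p * x - c (p - 1)"
      by (metis add_diff_cancel_left' of_int_diff of_int_mult)
    let ?c = "\<lambda>i. real_of_int (c i)"
    define S where "S = recips c m (k + 1)"
    have S: "recips c m k = S - 1 / (?c (p - 1) * ?c p)"
      "recips c m j = S + 1 / (?c p * ?c (p + 1))"
      using recips_Suc[of c m k] recips_Suc[of c m "k + 1"] 3 by (simp_all add: S_def p_def add_ac)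
    have idx: "m + int j = p + 1" "m + int (k + 1) = p" "m + int k = p - 1"
      using 3 by (auto simp: p_def)
    have "?c m * ?c (p + 1) * recips c m j = x * (?c m * ?c p * S) - ?c m * ?c (p - 1) * recips c m k"
    proof -
      have "?c (p + 1) * recips c m j = ?c (p + 1) * S + 1 / ?c p"
        unfolding S using nz by (simp add: algebra_simps)
      also have "\<dots> = x * (?c p * S) - ?c (p - 1) * recips c m k"
        unfolding S x using nz by (simp add: algebra_simps)
      finally have "?c m * (?c (p + 1) * recips c m j) = ?c m * (x * (?c p * S) - ?c (p - 1) * recips c m k)"
        by (rule arg_cong)
      then show ?thesis by (simp only: right_diff_distrib mult_ac)
    qed
    moreover have "x * (?c m * ?c p * S) \<in> \<int>" "?c m * ?c (p - 1) * recips c m k \<in> \<int>"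
      using less.IH[of "k + 1"] less.IH[of k] 3 unfolding idx S_def by auto
    ultimately show ?thesis unfolding idx by (metis Ints_diff)
  qed auto
qed

text \<open>The relations are proved for the real array \<open>F\<close>, which also has a row 0 of
  ones and a row \<open>n\<close> of squares; integrality carries them over to the floors.\<close>

lemma cycle_frieze_in_friezes_B:
  assumes c: "c \<in> farey_cycles (n + 1)" and n: "1 \<le> n"
  shows "cycle_frieze n c \<in> friezes_B n"
proof -
  let ?c = "\<lambda>i. real_of_int (c i)"
  let ?b = "cycle_frieze n c"
  define F where "F j m = ?c m * ?c (m + int j + 1) * recips c m (j + 1)" for j m
  have pos: "0 < c i" and per: "c (i + int (n + 1)) = c i"
    and dvd: "c i dvd c (i - 1) + c (i + 1)" and sum: "recips c i (n + 1) = 1" for i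
    using c by (auto simp: farey_cycles_def)
  have nz: "?c i \<noteq> 0" for i using pos[of i] by simp
  have F: "?b j m = F j m" if "j \<noteq> n" for j m
    using recips_integral[OF pos dvd, of m "j + 1"] that by (simp add: cycle_frieze_def F_def add_ac)
  have Fn: "F n m = (?c m)\<^sup>2" for m
    using per[of m] sum[of m] by (simp add: F_def power2_eq_square add_ac)
  have F0: "F 0 m = 1" for m using nz by (simp add: F_def recips_def)
  have "0 < recips c m (j + 1)" for j m
    using pos by (auto simp: recips_Suc intro!: add_nonneg_pos recips_nonneg)
  then have Fpos: "0 < F j m" for j m using pos by (simp add: F_def)
  have bpos: "0 < ?b j m" for j m
  proof (cases "j = n")
    case False
    then have "0 < real_of_int (?b j m)" using Fpos[of j m] by (simp only: F not_False_eq_True)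
    then show ?thesis by simp
  qed (simp add: cycle_frieze_def pos)
  have diamond: "F j m * F j (m + 1) = 1 + F (j - 1) (m + 1) * F (j + 1) m" if j1: "1 \<le> j" for j m
  proof -
    obtain k where k: "j = k + 1" using j1 by (cases j) auto
    define q where "q = m + int j + 1"
    define T where "T = recips c m (j + 1)"
    have "recips c (m + 1) (j + 1) = T + 1 / (?c q * ?c (q + 1)) - 1 / (?c m * ?c (m + 1))"
      using recips_Suc[of c "m + 1" j] recips_Suc_shift[of c m j] by (simp add: T_def q_def add_ac)
    moreover have "recips c (m + 1) (k + 1) = T - 1 / (?c m * ?c (m + 1))"
      using recips_Suc_shift[of c m j] by (simp add: T_def k)
    moreover have "recips c m (j + 2) = T + 1 / (?c q * ?c (q + 1))"
      using recips_Suc[of c m "j + 1"] by (simp add: T_def q_def add_ac)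
    ultimately show ?thesis
      using diamond_reciprocals[of "?c m" "?c (m + 1)" "?c q" "?c (q + 1)" T] nz k
      by (simp add: F_def T_def q_def add_ac mult_ac)
  qed
  \<comment> \<open>The \<open>n\<close> summands from \<open>m + 1\<close> on lack only the summand
    at \<open>m\<close> of a full turn; this gives the relation at the vertex
    \<open>n\<close>.\<close>
  have top: "F (n - 1) (m + 1) = ?c m * ?c (m + 1) - 1" for m
  proof -
    have "recips c (m + 1) n = 1 - 1 / (?c m * ?c (m + 1))"
      using recips_Suc_shift[of c m n] sum[of m] by simp
    moreover have "m + 1 + int (n - 1) + 1 = m + int (n + 1)" "n - 1 + 1 = n" using n by simp_all
    ultimately have "F (n - 1) (m + 1) = ?c (m + 1) * ?c (m + int (n + 1)) * (1 - 1 / (?c m * ?c (m + 1)))"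
      by (simp only: F_def)
    also have "\<dots> = ?c m * ?c (m + 1) - 1" unfolding per using nz by (simp add: field_simps)
    finally show ?thesis .
  qed
  have "real_of_int (?b j m * ?b j (m + 1)) =
      real_of_int (1 + (if j = 1 then 1 else ?b (j - 1) (m + 1)) *
       (if j = n then 1 else ?b (j + 1) m ^ (if j + 1 = n then 2 else 1)))"
    if j: "j \<in> {1..n}" for j m
  proof -
    have left: "real_of_int (if j = 1 then 1 else ?b (j - 1) (m + 1)) = F (j - 1) (m + 1)"
      using F[of "j - 1"] j F0 by auto
    show ?thesis
    proof (cases "j = n")
      case True
      then show ?thesis using left top[of m] by (simp add: cycle_frieze_def)
    next
      case False
      have "real_of_int (?b (j + 1) m ^ (if j + 1 = n then 2 else 1)) = F (j + 1) m"
        using F[of "j + 1"] Fn[of m] by (auto simp: cycle_frieze_def)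
      with False left diamond[of j m] j F[of j] show ?thesis by simp
    qed
  qed
  then show ?thesis
    using bpos unfolding friezes_B_def of_int_eq_iff by blast
qed

subsection \<open>Arbitrary orientations\<close>

text \<open>Rows are shifted against each other so that all arrows point away from the vertex 1.\<close>

fun row_shift :: "(nat \<times> nat) set \<Rightarrow> nat \<Rightarrow> int" where
  "row_shift R 0 = 0"
| "row_shift R (Suc j) = row_shift R j + (if (j, Suc j) \<in> R then 0 else 1)"

text \<open>The diagram is a path, and acyclicity orients each edge in exactly one way. So the two
  products together have one factor for each existing neighbour, and the direction only decides
  between \<open>g\<close> and \<open>h\<close>.\<close>

lemma path_orientation_products:
  fixes g h :: "nat \<Rightarrow> int"
  assumes R: "acyclic_orientation {1..n} (cartan_B n) R" and j: "j \<in> {1..n}"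
  shows "(\<Prod>i | (j, i) \<in> R. g i) * (\<Prod>i | (i, j) \<in> R. h i) =
    (if j = 1 then 1 else if (j - 1, j) \<in> R then h (j - 1) else g (j - 1)) *
    (if j = n then 1 else if (j, j + 1) \<in> R then g (j + 1) else h (j + 1))"
proof -
  have sub: "R \<subseteq> {1..n} \<times> {1..n}" and acyc: "acyclic R"
    and nb: "\<And>i j. i \<in> {1..n} \<Longrightarrow> j \<in> {1..n} \<Longrightarrow> i \<noteq> j \<Longrightarrow>
      cartan_B n i j \<noteq> 0 \<longleftrightarrow> (i, j) \<in> R \<or> (j, i) \<in> R"
    using R by (auto simp: acyclic_orientation_def)
  have irrefl: "(i, i) \<notin> R" for i using acyc unfolding acyclic_def by blast
  have asym: "(y, x) \<notin> R" if "(x, y) \<in> R" for x y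
  proof
    assume "(y, x) \<in> R"
    with that have "(x, x) \<in> R\<^sup>+" by (rule trancl_into_trancl[OF r_into_trancl])
    with acyc show False by (simp add: acyclic_def)
  qed
  have edge: "(j, i) \<in> R \<or> (i, j) \<in> R \<longleftrightarrow> i \<in> {1..n} \<and> (i = j + 1 \<or> j = i + 1)" for i
  proof (cases "i \<in> {1..n} \<and> i \<noteq> j")
    case True
    then show ?thesis using nb[of j i] j by (auto simp: cartan_B_def split: if_splits)
  next
    case False
    then have "(j, i) \<notin> R \<and> (i, j) \<notin> R" using irrefl[of j] sub by blast
    moreover have "\<not> (i \<in> {1..n} \<and> (i = j + 1 \<or> j = i + 1))" using False by auto
    ultimately show ?thesis by blast
  qed
  have ne: "j - 1 \<noteq> j + 1" "j + 1 \<noteq> j - 1" by simp_all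
  have left: "(j, j - 1) \<in> R \<longleftrightarrow> (j - 1, j) \<notin> R" if "j \<noteq> 1"
    using edge[of "j - 1"] asym[of j "j - 1"] j that by auto
  have right: "(j + 1, j) \<in> R \<longleftrightarrow> (j, j + 1) \<notin> R" if "j \<noteq> n"
    using edge[of "j + 1"] asym[of j "j + 1"] j that by auto
  have out: "(j, i) \<in> R \<longleftrightarrow> i = j - 1 \<and> j \<noteq> 1 \<and> (j - 1, j) \<notin> R \<or>
      i = j + 1 \<and> j \<noteq> n \<and> (j, j + 1) \<in> R"
    and inn: "(i, j) \<in> R \<longleftrightarrow> i = j - 1 \<and> j \<noteq> 1 \<and> (j - 1, j) \<in> R \<or>
      i = j + 1 \<and> j \<noteq> n \<and> (j, j + 1) \<notin> R" for i
  proof -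
    have "i = j + 1 \<and> j \<noteq> n \<or> i = j - 1 \<and> j \<noteq> 1 \<or> (j, i) \<notin> R \<and> (i, j) \<notin> R"
      using edge[of i] j by auto
    then consider "i = j + 1" "j \<noteq> n" | "i = j - 1" "j \<noteq> 1" | "(j, i) \<notin> R" "(i, j) \<notin> R"
      by blast
    then have "((j, i) \<in> R \<longleftrightarrow> i = j - 1 \<and> j \<noteq> 1 \<and> (j - 1, j) \<notin> R \<or>
        i = j + 1 \<and> j \<noteq> n \<and> (j, j + 1) \<in> R) \<and>
      ((i, j) \<in> R \<longleftrightarrow> i = j - 1 \<and> j \<noteq> 1 \<and> (j - 1, j) \<in> R \<or>
        i = j + 1 \<and> j \<noteq> n \<and> (j, j + 1) \<notin> R)"
    proof cases
      case 1
      then show ?thesis using right ne by simp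
    next
      case 2
      then show ?thesis using left ne by simp
    next
      case 3
      then show ?thesis using left right by auto
    qed
    then show "(j, i) \<in> R \<longleftrightarrow> i = j - 1 \<and> j \<noteq> 1 \<and> (j - 1, j) \<notin> R \<or>
        i = j + 1 \<and> j \<noteq> n \<and> (j, j + 1) \<in> R"
      "(i, j) \<in> R \<longleftrightarrow> i = j - 1 \<and> j \<noteq> 1 \<and> (j - 1, j) \<in> R \<or>
        i = j + 1 \<and> j \<noteq> n \<and> (j, j + 1) \<notin> R" by blast+
  qed
  have prod2: "(\<Prod>i | i = x \<and> P \<or> i = y \<and> Q. f i) = (if P then f x else 1) * (if Q then f y else 1)"
    if "x \<noteq> y" for x y :: nat and P Q and f :: "nat \<Rightarrow> int"
  proof -
    have "{i. i = x \<and> P \<or> i = y \<and> Q} = (if P then {x} else {}) \<union> (if Q then {y} else {})" by auto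
    then show ?thesis using that by simp
  qed
  show ?thesis
    unfolding Collect_cong[OF out] Collect_cong[OF inn] prod2[OF ne(1)] by simp
qed

text \<open>An edge directed towards the vertex 1 is compensated by one more unit of shift, so the
  factor from row \<open>j - 1\<close> is always read at \<open>m + 1\<close> and the one from row
  \<open>j + 1\<close> at \<open>m\<close>.\<close>

lemma friezes_iff_friezes_B:
  assumes R: "acyclic_orientation {1..n} (cartan_B n) R"
  shows "a \<in> friezes {1..n} (cartan_B n) R \<longleftrightarrow>
    a \<in> extensional ({1..n} \<times> UNIV) \<and> (\<lambda>j m. a (j, m + row_shift R j)) \<in> friezes_B n"
proof -
  let ?b = "\<lambda>j m. a (j, m + row_shift R j)"
  have rel: "(\<Prod>i | (j, i) \<in> R. a (i, m + row_shift R j) ^ nat \<bar>cartan_B n i j\<bar>) *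
      (\<Prod>i | (i, j) \<in> R. a (i, m + row_shift R j + 1) ^ nat \<bar>cartan_B n i j\<bar>) =
      (if j = 1 then 1 else ?b (j - 1) (m + 1)) *
       (if j = n then 1 else ?b (j + 1) m ^ (if j + 1 = n then 2 else 1))"
    if j: "j \<in> {1..n}" for j m
  proof -
    have left: "(if (j - 1, j) \<in> R then a (j - 1, m + row_shift R j + 1) ^ nat \<bar>cartan_B n (j - 1) j\<bar>
        else a (j - 1, m + row_shift R j) ^ nat \<bar>cartan_B n (j - 1) j\<bar>) = ?b (j - 1) (m + 1)"
      if "j \<noteq> 1"
    proof -
      obtain k where "j = Suc k" using j by (cases j) auto
      then show ?thesis using j that by (simp add: cartan_B_def add_ac)
    qed
    have "nat \<bar>cartan_B n (j + 1) j\<bar> = (if j + 1 = n then 2 else 1)"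
      by (simp add: cartan_B_def)
    then have right: "(if (j, j + 1) \<in> R then a (j + 1, m + row_shift R j) ^ nat \<bar>cartan_B n (j + 1) j\<bar>
        else a (j + 1, m + row_shift R j + 1) ^ nat \<bar>cartan_B n (j + 1) j\<bar>) =
        ?b (j + 1) m ^ (if j + 1 = n then 2 else 1)"
      by (simp add: add_ac)
    show ?thesis
      unfolding path_orientation_products[OF R j] right using left by simp
  qed
  have shift: "(\<forall>m. P m) \<longleftrightarrow> (\<forall>m. P (m + s))" for P and s :: int
    by (metis diff_add_cancel)
  have "(\<forall>m. 0 < a (j, m) \<and> a (j, m) * a (j, m + 1) =
          1 + (\<Prod>i | (j, i) \<in> R. a (i, m) ^ nat \<bar>cartan_B n i j\<bar>)
            * (\<Prod>i | (i, j) \<in> R. a (i, m + 1) ^ nat \<bar>cartan_B n i j\<bar>)) \<longleftrightarrow>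
      (\<forall>m. 0 < ?b j m \<and> ?b j m * ?b j (m + 1) = 1 + (if j = 1 then 1 else ?b (j - 1) (m + 1)) *
       (if j = n then 1 else ?b (j + 1) m ^ (if j + 1 = n then 2 else 1)))"
    (is "(\<forall>m. ?P m) \<longleftrightarrow> (\<forall>m. ?Q m)") if j: "j \<in> {1..n}" for j
  proof -
    have PQ: "?P (m + row_shift R j) \<longleftrightarrow> ?Q m" for m
    proof -
      have "m + row_shift R j + 1 = m + 1 + row_shift R j" by simp
      then show ?thesis unfolding rel[OF j] by (simp only:)
    qed
    have "(\<forall>m. ?P m) \<longleftrightarrow> (\<forall>m. ?P (m + row_shift R j))" by (rule shift)
    also have "\<dots> \<longleftrightarrow> (\<forall>m. ?Q m)" by (simp only: PQ)
    finally show ?thesis .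
  qed
  then have *: "(\<forall>j\<in>{1..n}. \<forall>m. 0 < a (j, m) \<and> a (j, m) * a (j, m + 1) =
          1 + (\<Prod>i | (j, i) \<in> R. a (i, m) ^ nat \<bar>cartan_B n i j\<bar>)
            * (\<Prod>i | (i, j) \<in> R. a (i, m + 1) ^ nat \<bar>cartan_B n i j\<bar>)) \<longleftrightarrow> ?b \<in> friezes_B n"
    unfolding friezes_B_def mem_Collect_eq by (rule ball_cong[OF refl])
  show ?thesis
    unfolding *[symmetric] by (auto simp: friezes_def PiE_def)
qed

lemma friezes_B_cong:
  assumes "\<And>j m. j \<in> {1..n} \<Longrightarrow> b j m = b' j m"
  shows "b \<in> friezes_B n \<longleftrightarrow> b' \<in> friezes_B n"
proof -
  have "b (j - 1) m = b' (j - 1) m" if "j \<in> {1..n}" "j \<noteq> 1" for j m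
    using that by (intro assms) auto
  moreover have "b (j + 1) m = b' (j + 1) m" if "j \<in> {1..n}" "j \<noteq> n" for j m
    using that by (intro assms) auto
  ultimately show ?thesis
    using assms by (auto simp: friezes_B_def)
qed

text \<open>Injectivity is the determination by the last row; surjectivity comes from
  \<open>cycle_frieze\<close> with the shifts undone.\<close>

lemma bij_betw_friezes_farey_cycles:
  assumes n: "1 \<le> n" and R: "acyclic_orientation {1..n} (cartan_B n) R"
  shows "bij_betw (\<lambda>a m. a (n, m + row_shift R n)) (friezes {1..n} (cartan_B n) R) (farey_cycles (n + 1))"
  unfolding bij_betw_def
proof (intro conjI inj_onI equalityI subsetI)
  fix a a' assume a: "a \<in> friezes {1..n} (cartan_B n) R" "a' \<in> friezes {1..n} (cartan_B n) R"
    and eq: "(\<lambda>m. a (n, m + row_shift R n)) = (\<lambda>m. a' (n, m + row_shift R n))"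
  show "a = a'"
  proof (rule extensionalityI[of _ "{1..n} \<times> UNIV"])
    show "a \<in> extensional ({1..n} \<times> UNIV)" "a' \<in> extensional ({1..n} \<times> UNIV)"
      using a friezes_iff_friezes_B[OF R] by blast+
    fix x :: "nat \<times> int" assume "x \<in> {1..n} \<times> UNIV"
    then obtain j m where x: "x = (j, m)" "j \<in> {1..n}" by auto
    have "(\<lambda>j m. a (j, m + row_shift R j)) \<in> friezes_B n"
      "(\<lambda>j m. a' (j, m + row_shift R j)) \<in> friezes_B n"
      using a friezes_iff_friezes_B[OF R] by blast+
    then have "(\<lambda>m. a (j, m + row_shift R j)) = (\<lambda>m. a' (j, m + row_shift R j))"
      using frieze_determined_by_last_row[of "\<lambda>j m. a (j, m + row_shift R j)" n
          "\<lambda>j m. a' (j, m + row_shift R j)" j] eq x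
      by blast
    from fun_cong[OF this, of "m - row_shift R j"] show "a x = a' x" using x by simp
  qed
next
  fix c assume "c \<in> (\<lambda>a m. a (n, m + row_shift R n)) ` friezes {1..n} (cartan_B n) R"
  then obtain a where c: "c = (\<lambda>m. a (n, m + row_shift R n))"
    and "a \<in> friezes {1..n} (cartan_B n) R" by blast
  then have "(\<lambda>j m. a (j, m + row_shift R j)) \<in> friezes_B n"
    using friezes_iff_friezes_B[OF R] by blast
  from frieze_last_row_in_farey_cycles[OF this n] show "c \<in> farey_cycles (n + 1)"
    by (simp only: c)
next
  fix c assume c: "c \<in> farey_cycles (n + 1)"
  \<comment> \<open>The restriction supplies \<open>undefined\<close> off the vertex set, as
    membership in \<open>friezes\<close> demands.\<close>
  define a where "a = restrict (\<lambda>(j, m). cycle_frieze n c j (m - row_shift R j)) ({1..n} \<times> UNIV)"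
  have a: "a (j, m + row_shift R j) = cycle_frieze n c j m" if "j \<in> {1..n}" for j m
    using that by (simp add: a_def)
  have "a \<in> friezes {1..n} (cartan_B n) R"
    unfolding friezes_iff_friezes_B[OF R]
    using friezes_B_cong[of n "\<lambda>j m. a (j, m + row_shift R j)" "cycle_frieze n c"] a
      cycle_frieze_in_friezes_B[OF c n] by (simp add: a_def)
  moreover have "c = (\<lambda>m. a (n, m + row_shift R n))"
    using a[of n] n by (auto simp: cycle_frieze_def)
  ultimately show "c \<in> (\<lambda>a m. a (n, m + row_shift R n)) ` friezes {1..n} (cartan_B n) R"
    by blast
qed

theorem theorem3p3:
  fixes n :: nat and R :: "(nat \<times> nat) set"
  assumes "n \<ge> 1"
    and "acyclic_orientation {1..n} (cartan_B n) R"
  shows "card (friezes {1..n} (cartan_B n) R) =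
    (\<Sum>m :: nat | 1 \<le> m \<and> real m \<le> sqrt (real (n + 1)). (2 * n - m ^ 2 + 1) choose n)"
  using bij_betw_same_card[OF bij_betw_friezes_farey_cycles[OF assms]] card_farey_cycles[OF assms(1)]
  by simp

end
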